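(* Let $\mathcal Z$ be a discrete number system with associated partial order $\mathcal Z_\le$, and let $\{+x\}_\le$ be the partial order formed by the automorphisms $+x:\mathcal Z_\le\to\mathcal Z_\le$ ($x$ an object of $\mathcal Z$). Then there is an isomorphism (of partial orders, viewed as categories) $\oplus:\mathcal Z_\le\to\{+x\}_\le$. Moreover, given any $a\le b$ in $\mathcal Z_\le$, there is a natural transformation $+a\to +b$.
   Context: A discrete number system $\mathcal Z$ is a nonempty collection of objects with arrows such that every object is the source of exactly one arrow and the target of exactly one arrow, the objects and arrows being arranged in a single two-way infinite chain $\cdots\to -2\to -1\to 0\to 1\to 2\to\cdots$ (one object is chosen and called $0$), and the arrows are components of a strict total order. Adding one transitive arrow for each composable pair (repeatedly) gives $\mathcal Z_<$; adding one reflexive arrow to each object of $\mathcal Z_<$ gives the partial order $\mathcal Z_\le$. For an object $x$, $x+1$ denotes the target of the unique arrow with source $x$, and $x-1$ denotes the source of the unique arrow with target $x$. A partial order is regarded as a category with exactly one arrow $a\to b$ when $a\le b$ and none otherwise; order preserving functions are the same as functors. Automorphisms $+x:\mathcal Z_\le\to\mathcal Z_\le$ are defined as follows: $+0$ is the identity; $+1$ sends each object to the target of its arrow in $\mathcal Z$; $+(-1)$ is the inverse of $+1$; $+(x+1):=(+1)\circ(+x)$ for $0<x+1$; and $+(x-1):=(+(-1))\circ(+x)$ for $x-1<0$. The order on $\{+x\}_\le$ is: $F\le G$ iff $F(a)\le G(a)$ for every object $a$ of $\mathcal Z_\le$. A functor is an isomorphism if its object and arrow functions are bijective. The map $\oplus$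 is given on objects by $x\mapsto +x$. *)

theory Defs
  imports "Graph_Theory.Digraph_Component" "HOL-Library.FuncSet"
begin

section \<open>Small categories, functors, natural transformations\<close>

record ('o, 'm) category = "('o, 'm) pre_digraph" +
  ident :: "'o \<Rightarrow> 'm"
  comp :: "'m \<Rightarrow> 'm \<Rightarrow> 'm"  \<comment> \<open>\<open>comp C g f\<close> is ``first \<open>f\<close>, then \<open>g\<close>''\<close>

definition hom_set :: "('o, 'm) category \<Rightarrow> 'o \<Rightarrow> 'o \<Rightarrow> 'm set" where
  "hom_set C x y = {f \<in> arcs C. tail C f = x \<and> head C f = y}"

definition is_category :: "('o, 'm) category \<Rightarrow> bool" where
  "is_category C \<longleftrightarrow>
     (\<forall>f\<in>arcs C. tail C f \<in> verts C \<and> head C f \<in> verts C) \<and>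
     (\<forall>x\<in>verts C. ident C x \<in> hom_set C x x) \<and>
     (\<forall>x\<in>verts C. \<forall>y\<in>verts C. \<forall>z\<in>verts C. \<forall>f\<in>hom_set C x y. \<forall>g\<in>hom_set C y z.
        comp C g f \<in> hom_set C x z) \<and>
     (\<forall>x\<in>verts C. \<forall>y\<in>verts C. \<forall>f\<in>hom_set C x y.
        comp C f (ident C x) = f \<and> comp C (ident C y) f = f) \<and>
     (\<forall>w\<in>verts C. \<forall>x\<in>verts C. \<forall>y\<in>verts C. \<forall>z\<in>verts C.
        \<forall>f\<in>hom_set C w x. \<forall>g\<in>hom_set C x y. \<forall>h\<in>hom_set C y z.
        comp C h (comp C g f) = comp C (comp C h g) f)"

record ('o, 'm, 'p, 'n) functor_maps =
  obj_map :: "'o \<Rightarrow> 'p"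
  arr_map :: "'m \<Rightarrow> 'n"

definition is_functor ::
  "('o, 'm) category \<Rightarrow> ('p, 'n) category \<Rightarrow> ('o, 'm, 'p, 'n) functor_maps \<Rightarrow> bool" where
  "is_functor C D F \<longleftrightarrow> is_category C \<and> is_category D \<and>
     (\<forall>x\<in>verts C. obj_map F x \<in> verts D) \<and>
     (\<forall>x\<in>verts C. \<forall>y\<in>verts C. \<forall>f\<in>hom_set C x y.
        arr_map F f \<in> hom_set D (obj_map F x) (obj_map F y)) \<and>
     (\<forall>x\<in>verts C. arr_map F (ident C x) = ident D (obj_map F x)) \<and>
     (\<forall>x\<in>verts C. \<forall>y\<in>verts C. \<forall>z\<in>verts C. \<forall>f\<in>hom_set C x y. \<forall>g\<in>hom_set C y z.
        arr_map F (comp C g f) = comp D (arr_map F g) (arr_map F f))"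

definition is_isomorphism ::
  "('o, 'm) category \<Rightarrow> ('p, 'n) category \<Rightarrow> ('o, 'm, 'p, 'n) functor_maps \<Rightarrow> bool" where
  "is_isomorphism C D F \<longleftrightarrow> is_functor C D F \<and>
     bij_betw (obj_map F) (verts C) (verts D) \<and> bij_betw (arr_map F) (arcs C) (arcs D)"

definition is_natural_transformation ::
  "('o, 'm) category \<Rightarrow> ('p, 'n) category \<Rightarrow> ('o, 'm, 'p, 'n) functor_maps \<Rightarrow>
     ('o, 'm, 'p, 'n) functor_maps \<Rightarrow> ('o \<Rightarrow> 'n) \<Rightarrow> bool" where
  "is_natural_transformation C D F G \<eta> \<longleftrightarrow> is_functor C D F \<and> is_functor C D G \<and>
     (\<forall>x\<in>verts C. \<eta> x \<in> hom_set D (obj_map F x) (obj_map G x)) \<and>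
     (\<forall>x\<in>verts C. \<forall>y\<in>verts C. \<forall>f\<in>hom_set C x y.
        comp D (arr_map G f) (\<eta> x) = comp D (\<eta> y) (arr_map F f))"


section \<open>Partial orders as categories\<close>

text \<open>The unique arrow from \<open>a\<close> to \<open>b\<close>, present when \<open>a \<le> b\<close>, is the pair \<open>(a, b)\<close>.\<close>

definition order_category :: "'a set \<Rightarrow> 'a rel \<Rightarrow> ('a, 'a \<times> 'a) category" where
  "order_category A r =
     \<lparr>verts = A, arcs = r, tail = fst, head = snd,
      ident = (\<lambda>x. (x, x)), comp = (\<lambda>g f. (fst f, snd g))\<rparr>"

text \<open>An order preserving function, regarded as a functor: there is only one possible arrow map.\<close>

definition order_functor :: "('a \<Rightarrow> 'b) \<Rightarrow> ('a, 'a \<times> 'a, 'b, 'b \<times> 'b) functor_maps" where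
  "order_functor f = \<lparr>obj_map = f, arr_map = map_prod f f\<rparr>"


section \<open>Discrete number systems\<close>

text \<open>
  Unique outgoing and incoming arrows only say that the system is a disjoint union of directed
  cycles and two-way infinite chains. Cycles are excluded by containment in a strict total order,
  several chains by connectedness (which also makes the set of objects nonempty). That the result
  is one chain indexed by the integers is lemma \<open>chain\<close> below.
\<close>

locale discrete_number_system = wf_digraph Z
  for Z :: "('o, 'a) pre_digraph" and zero :: 'o +
  assumes zero_in_verts: "zero \<in> verts Z"
    and unique_out_arc: "x \<in> verts Z \<Longrightarrow> \<exists>!e. e \<in> out_arcs Z x"
    and unique_in_arc: "x \<in> verts Z \<Longrightarrow> \<exists>!e. e \<in> in_arcs Z x"
    and strict_order: "\<exists>r. strict_linear_order_on (verts Z) r \<and> arcs_ends Z \<subseteq> r"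
    and single_chain: "connected Z"

definition next_obj :: "('o, 'a) pre_digraph \<Rightarrow> 'o \<Rightarrow> 'o" where
  "next_obj Z x = head Z (THE e. e \<in> out_arcs Z x)"

definition prev_obj :: "('o, 'a) pre_digraph \<Rightarrow> 'o \<Rightarrow> 'o" where
  "prev_obj Z x = tail Z (THE e. e \<in> in_arcs Z x)"

definition less_rel :: "('o, 'a) pre_digraph \<Rightarrow> 'o rel" where
  "less_rel Z = (arcs_ends Z)\<^sup>+"

definition le_rel :: "('o, 'a) pre_digraph \<Rightarrow> 'o rel" where
  "le_rel Z = less_rel Z \<union> Id_on (verts Z)"

definition le_category :: "('o, 'a) pre_digraph \<Rightarrow> ('o, 'o \<times> 'o) category" where
  "le_category Z = order_category (verts Z) (le_rel Z)"


section \<open>The automorphisms \<open>+x\<close>\<close>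

text \<open>
  An automorphism of the partial order is represented by its object function, made extensional
  (\<open>undefined\<close> off the objects) so that equality of functions is equality of automorphisms.
\<close>

definition plus_one :: "('o, 'a) pre_digraph \<Rightarrow> 'o \<Rightarrow> 'o" where
  "plus_one Z = restrict (next_obj Z) (verts Z)"

definition plus_minus_one :: "('o, 'a) pre_digraph \<Rightarrow> 'o \<Rightarrow> 'o" where
  "plus_minus_one Z = restrict (inv_into (verts Z) (plus_one Z)) (verts Z)"

text \<open>
  The recursion defining \<open>+x\<close> runs over the objects of \<open>Z\<close>, upwards and downwards from \<open>zero\<close>;
  it is given by its graph, which lemma \<open>plus_graph_unique\<close> below shows to be functional and total.
\<close>

inductive plus_graph :: "('o, 'a) pre_digraph \<Rightarrow> 'o \<Rightarrow> 'o \<Rightarrow> ('o \<Rightarrow> 'o) \<Rightarrow> bool"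
  for Z zero where
  zero: "plus_graph Z zero zero (restrict id (verts Z))"
| one: "plus_graph Z zero (next_obj Z zero) (plus_one Z)"
| minus_one: "plus_graph Z zero (prev_obj Z zero) (plus_minus_one Z)"
| up: "plus_graph Z zero x F \<Longrightarrow> (zero, next_obj Z x) \<in> less_rel Z \<Longrightarrow>
    plus_graph Z zero (next_obj Z x) (compose (verts Z) (plus_one Z) F)"
| down: "plus_graph Z zero x F \<Longrightarrow> (prev_obj Z x, zero) \<in> less_rel Z \<Longrightarrow>
    plus_graph Z zero (prev_obj Z x) (compose (verts Z) (plus_minus_one Z) F)"

definition plus_aut :: "('o, 'a) pre_digraph \<Rightarrow> 'o \<Rightarrow> 'o \<Rightarrow> 'o \<Rightarrow> 'o" where
  "plus_aut Z zero x = (THE F. plus_graph Z zero x F)"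

definition plus_auts :: "('o, 'a) pre_digraph \<Rightarrow> 'o \<Rightarrow> ('o \<Rightarrow> 'o) set" where
  "plus_auts Z zero = plus_aut Z zero ` verts Z"

definition plus_auts_le :: "('o, 'a) pre_digraph \<Rightarrow> 'o \<Rightarrow> ('o \<Rightarrow> 'o) rel" where
  "plus_auts_le Z zero =
     {(F, G). F \<in> plus_auts Z zero \<and> G \<in> plus_auts Z zero \<and>
        (\<forall>a\<in>verts Z. (F a, G a) \<in> le_rel Z)}"

definition plus_auts_category ::
  "('o, 'a) pre_digraph \<Rightarrow> 'o \<Rightarrow> ('o \<Rightarrow> 'o, ('o \<Rightarrow> 'o) \<times> ('o \<Rightarrow> 'o)) category" where
  "plus_auts_category Z zero =
     order_category (plus_auts Z zero) (plus_auts_le Z zero)"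


section \<open>Well-definedness\<close>

context discrete_number_system
begin

abbreviation "nx \<equiv> next_obj Z"
abbreviation "pv \<equiv> prev_obj Z"

lemma out_arc_the: assumes "x \<in> verts Z"
  shows "(THE e. e \<in> out_arcs Z x) \<in> arcs Z" "tail Z (THE e. e \<in> out_arcs Z x) = x"
  using theI'[OF unique_out_arc[OF assms]] by auto

lemma in_arc_the: assumes "x \<in> verts Z"
  shows "(THE e. e \<in> in_arcs Z x) \<in> arcs Z" "head Z (THE e. e \<in> in_arcs Z x) = x"
  using theI'[OF unique_in_arc[OF assms]] by auto

lemma nx_in: "x \<in> verts Z \<Longrightarrow> nx x \<in> verts Z"
  unfolding next_obj_def using out_arc_the head_in_verts by blast

lemma pv_in: "x \<in> verts Z \<Longrightarrow> pv x \<in> verts Z"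
  unfolding prev_obj_def using in_arc_the tail_in_verts by blast

lemma arc_nx: "e \<in> arcs Z \<Longrightarrow> head Z e = nx (tail Z e)"
  unfolding next_obj_def
  by (rule arg_cong[of _ _ "head Z"], rule sym, rule the1_equality[OF unique_out_arc]) auto

lemma arc_pv: "e \<in> arcs Z \<Longrightarrow> tail Z e = pv (head Z e)"
  unfolding prev_obj_def
  by (rule arg_cong[of _ _ "tail Z"], rule sym, rule the1_equality[OF unique_in_arc]) auto

lemma pv_nx: "x \<in> verts Z \<Longrightarrow> pv (nx x) = x"
  using arc_pv[OF out_arc_the(1)] arc_nx[OF out_arc_the(1)] out_arc_the(2) by metis

lemma nx_pv: "x \<in> verts Z \<Longrightarrow> nx (pv x) = x"
  using arc_nx[OF in_arc_the(1)] arc_pv[OF in_arc_the(1)] in_arc_the(2) by metis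

lemma arcs_ends_iff: "(x, y) \<in> arcs_ends Z \<longleftrightarrow> x \<in> verts Z \<and> y = nx x"
proof
  assume "(x, y) \<in> arcs_ends Z"
  then show "x \<in> verts Z \<and> y = nx x" using arc_nx by (auto simp: arcs_ends_conv)
next
  assume *: "x \<in> verts Z \<and> y = nx x"
  then have "(x, y) = (tail Z (THE e. e \<in> out_arcs Z x), head Z (THE e. e \<in> out_arcs Z x))"
    using out_arc_the by (auto simp: next_obj_def)
  then show "(x, y) \<in> arcs_ends Z" unfolding arcs_ends_conv using * out_arc_the(1) by blast
qed

lemma less_irrefl: "(x, x) \<notin> less_rel Z"
proof
  assume "(x, x) \<in> less_rel Z"
  moreover obtain r where r: "strict_linear_order_on (verts Z) r" "arcs_ends Z \<subseteq> r"
    using strict_order by blast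
  then have "(arcs_ends Z)\<^sup>+ \<subseteq> r\<^sup>+" by (auto intro: trancl_mono)
  moreover have "r\<^sup>+ = r" using r by (simp add: strict_linear_order_on_def)
  ultimately show False using r by (auto simp: strict_linear_order_on_def irrefl_def less_rel_def)
qed

definition ch :: "int \<Rightarrow> 'o" where
  "ch n = (if 0 \<le> n then (nx ^^ nat n) zero else (pv ^^ nat (- n)) zero)"

lemma funpow_in: "(nx ^^ n) zero \<in> verts Z" "(pv ^^ n) zero \<in> verts Z"
  by (induction n) (auto simp: zero_in_verts nx_in pv_in)

lemma ch_in: "ch n \<in> verts Z"
  by (simp add: ch_def funpow_in)

lemma ch_0: "ch 0 = zero"
  by (simp add: ch_def)

lemma ch_Suc: "ch (n + 1) = nx (ch n)"
proof (cases "0 \<le> n")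
  case True
  then show ?thesis by (simp add: ch_def nat_add_distrib)
next
  case False
  then obtain k where k: "n = - int (Suc k)" by (metis negD not_le)
  have 1: "ch n = (pv ^^ Suc k) zero" by (simp add: ch_def k nat_add_distrib)
  have 2: "ch (n + 1) = (pv ^^ k) zero"
    by (cases k) (auto simp: ch_def k nat_add_distrib)
  show ?thesis unfolding 1 2 using nx_pv funpow_in by simp
qed

lemma ch_pred: "ch (n - 1) = pv (ch n)"
  using ch_Suc[of "n - 1"] pv_nx[OF ch_in, of "n - 1"] by simp

lemma ch_less: "m < n \<Longrightarrow> (ch m, ch n) \<in> less_rel Z"
proof (induction n rule: int_gr_induct)
  case base
  show ?case unfolding less_rel_def
    by (rule r_into_trancl) (simp add: arcs_ends_iff ch_Suc ch_in)
next
  case (step i)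
  have "(ch i, ch (i + 1)) \<in> arcs_ends Z" by (simp add: arcs_ends_iff ch_Suc ch_in)
  with step show ?case unfolding less_rel_def by (rule_tac trancl_into_trancl)
qed

lemma ch_less_iff: "(ch m, ch n) \<in> less_rel Z \<longleftrightarrow> m < n"
proof
  assume *: "(ch m, ch n) \<in> less_rel Z"
  show "m < n"
  proof (rule ccontr)
    assume "\<not> m < n"
    then consider "m = n" | "n < m" by linarith
    then show False
    proof cases
      case 1 then show False using * less_irrefl by auto
    next
      case 2
      then have "(ch m, ch m) \<in> less_rel Z" using * ch_less[OF 2]
        unfolding less_rel_def by (meson trancl_trans)
      then show False using less_irrefl by auto
    qed
  qed
qed (rule ch_less)

lemma ch_eq_iff: "ch m = ch n \<longleftrightarrow> m = n"
  using ch_less_iff less_irrefl by (metis linorder_neqE)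

lemma ch_surj: assumes "x \<in> verts Z" obtains n where "x = ch n"
proof -
  have "(zero, x) \<in> rtrancl_on (verts Z) ((arcs_ends Z)\<^sup>s)"
    using single_chain assms zero_in_verts by (auto simp: connected_conv)
  then have "\<exists>n. x = ch n"
  proof (induction rule: rtrancl_on_induct)
    case base
    show ?case using ch_0 by metis
  next
    case (step y z)
    then obtain n where n: "y = ch n" by auto
    from step(2) have "z = nx y \<or> y = nx z"
      by (auto simp: symcl_def arcs_ends_iff)
    then show ?case
    proof
      assume "z = nx y" then show ?thesis using n ch_Suc by metis
    next
      assume "y = nx z" then have "z = pv y" using pv_nx step by auto
      then show ?thesis using n ch_pred by metis
    qed
  qed
  then show ?thesis using that by auto
qed

lemma chain:
  "bij_betw ch UNIV (verts Z)" "ch 0 = zero" "arcs_ends Z = range (\<lambda>n. (ch n, ch (n + 1)))"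
proof -
  show "bij_betw ch UNIV (verts Z)"
    using ch_in by (auto simp: bij_betw_def inj_on_def ch_eq_iff elim: ch_surj)
  show "arcs_ends Z = range (\<lambda>n. (ch n, ch (n + 1)))"
    by (auto simp: arcs_ends_iff ch_Suc ch_in elim!: ch_surj)
qed (rule ch_0)

lemma le_ch_iff: "(ch m, ch n) \<in> le_rel Z \<longleftrightarrow> m \<le> n"
  by (auto simp: le_rel_def ch_less_iff ch_eq_iff ch_in Id_on_iff)

lemma le_rel_in: "le_rel Z \<subseteq> verts Z \<times> verts Z"
  unfolding le_rel_def less_rel_def using reachable1_in_verts by auto

lemma le_rel_linear_order: "linear_order_on (verts Z) (le_rel Z)"
proof -
  have "(x, z) \<in> le_rel Z" if "(x, y) \<in> le_rel Z" "(y, z) \<in> le_rel Z" for x y z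
    using that unfolding le_rel_def less_rel_def by (auto intro: trancl_trans)
  then have "trans (le_rel Z)" by (rule transI)
  moreover have "antisym (le_rel Z)"
    using less_irrefl unfolding antisym_def le_rel_def less_rel_def by (auto dest: trancl_trans)
  moreover have "refl_on (verts Z) (le_rel Z)"
    by (auto simp: refl_on_def le_rel_def)
  moreover have "total_on (verts Z) (le_rel Z)"
    unfolding total_on_def by (metis ch_surj le_ch_iff linear)
  ultimately show ?thesis using le_rel_in
    by (simp add: linear_order_on_def partial_order_on_def preorder_on_def)
qed

definition ix :: "'o \<Rightarrow> int" where "ix x = (THE n. x = ch n)"

definition shift :: "int \<Rightarrow> 'o \<Rightarrow> 'o" where
  "shift m = (\<lambda>a\<in>verts Z. ch (ix a + m))"

lemma ix_ch [simp]: "ix (ch n) = n"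
  by (simp add: ix_def ch_eq_iff)

lemma shift_ch [simp]: "shift m (ch n) = ch (n + m)"
  by (simp add: shift_def ch_in)

lemma shift_eqI:
  assumes "F \<in> extensional (verts Z)" "\<And>n. F (ch n) = ch (n + m)" shows "F = shift m"
proof (rule extensionalityI[OF assms(1)])
  show "shift m \<in> extensional (verts Z)" by (simp add: shift_def)
  fix x assume "x \<in> verts Z"
  then show "F x = shift m x" using assms(2) by (auto elim: ch_surj)
qed

lemma shift_0: "restrict id (verts Z) = shift 0"
  by (rule shift_eqI) (auto simp: ch_in)

lemma plus_one_shift: "plus_one Z = shift 1"
  by (rule shift_eqI) (auto simp: plus_one_def ch_in ch_Suc)

lemma plus_minus_one_shift: "plus_minus_one Z = shift (- 1)"
proof (rule shift_eqI)
  fix n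
  have inj: "inj_on (plus_one Z) (verts Z)"
    unfolding plus_one_shift inj_on_def by (metis ch_surj shift_ch ch_eq_iff add_right_cancel)
  have "inv_into (verts Z) (plus_one Z) (plus_one Z (ch (n - 1))) = ch (n - 1)"
    by (rule inv_into_f_f[OF inj ch_in])
  then show "plus_minus_one Z (ch n) = ch (n + - 1)"
    by (simp add: plus_minus_one_def ch_in plus_one_shift)
qed (auto simp: plus_minus_one_def)

lemma compose_shift: "compose (verts Z) (shift k) (shift m) = shift (m + k)"
  by (rule shift_eqI) (auto simp: compose_eq ch_in add.assoc)

lemma plus_graph_shiftD: "plus_graph Z zero x F \<Longrightarrow> \<exists>m. x = ch m \<and> F = shift m"
proof (induction rule: plus_graph.induct)
  case zero then show ?case using shift_0 ch_0 by metis
next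
  case one then show ?case using plus_one_shift ch_0 ch_Suc[of 0] by force
next
  case minus_one then show ?case using plus_minus_one_shift ch_0 ch_pred[of 0] by force
next
  case (up x F)
  then show ?case using ch_Suc plus_one_shift compose_shift by metis
next
  case (down x F)
  then obtain m where "x = ch m" "F = shift m" by auto
  then have "pv x = ch (m - 1)" "compose (verts Z) (plus_minus_one Z) F = shift (m - 1)"
    by (simp_all add: ch_pred plus_minus_one_shift compose_shift)
  then show ?case by blast
qed

lemma plus_graph_shift: "plus_graph Z zero (ch m) (shift m)"
proof (induction m rule: int_induct[of _ 0])
  case base
  show ?case using plus_graph.zero[of Z zero] by (simp add: ch_0 shift_0)
next
  case (step1 i)
  then have "(zero, nx (ch i)) \<in> less_rel Z"
    using ch_less_iff[of 0 "i + 1"] by (simp add: ch_0 ch_Suc)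
  from plus_graph.up[OF step1(2) this] show ?case
    by (simp add: ch_Suc plus_one_shift compose_shift)
next
  case (step2 i)
  then have "(pv (ch i), zero) \<in> less_rel Z"
    using ch_less_iff[of "i - 1" 0] by (simp add: ch_0 ch_pred)
  from plus_graph.down[OF step2(2) this] show ?case
    by (simp add: ch_pred plus_minus_one_shift compose_shift)
qed

lemma plus_graph_unique: "x \<in> verts Z \<Longrightarrow> \<exists>!F. plus_graph Z zero x F"
  by (metis ch_surj plus_graph_shift plus_graph_shiftD ch_eq_iff)

lemma plus_graph_plus: "x \<in> verts Z \<Longrightarrow> plus_graph Z zero x (plus_aut Z zero x)"
  unfolding plus_aut_def by (rule theI'[OF plus_graph_unique])

lemma plus_shift: "plus_aut Z zero (ch m) = shift m"
  using plus_graph_plus[OF ch_in] plus_graph_shiftD ch_eq_iff by metis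

lemma is_category_order:
  assumes "partial_order_on A r" shows "is_category (order_category A r)"
  using partial_order_onD[OF assms] unfolding is_category_def order_category_def hom_set_def
  by (auto simp: refl_on_def dest: transD)

lemma plus_automorphism:
  assumes "x \<in> verts Z"
  shows "is_isomorphism (le_category Z) (le_category Z) (order_functor (plus_aut Z zero x))"
proof -
  obtain m where m: "x = ch m" using assms ch_surj by blast
  have cat: "is_category (le_category Z)"
    using le_rel_linear_order is_category_order by (auto simp: le_category_def linear_order_on_def)
  have mono: "(shift m a, shift m b) \<in> le_rel Z \<longleftrightarrow> (a, b) \<in> le_rel Z"
    if "a \<in> verts Z" "b \<in> verts Z" for a b
    using that by (auto simp: le_ch_iff elim!: ch_surj)
  have sin: "shift m a \<in> verts Z" if "a \<in> verts Z" for a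
    using that by (auto simp: ch_in elim!: ch_surj)
  have inj: "inj_on (shift m) (verts Z)"
    unfolding inj_on_def by (metis ch_surj shift_ch ch_eq_iff add_right_cancel)
  have surj: "\<exists>a\<in>verts Z. b = shift m a" if b: "b \<in> verts Z" for b
  proof -
    obtain n where "b = ch n" using b ch_surj by blast
    then have "b = shift m (ch (n - m))" by simp
    then show ?thesis using ch_in by blast
  qed
  have "is_functor (le_category Z) (le_category Z) (order_functor (shift m))"
    using cat sin mono le_rel_in unfolding is_functor_def
    by (auto simp: le_category_def order_category_def order_functor_def hom_set_def)
  moreover have "bij_betw (shift m) (verts Z) (verts Z)"
    using inj sin surj by (auto simp: bij_betw_def)
  moreover have "bij_betw (map_prod (shift m) (shift m)) (le_rel Z) (le_rel Z)"
  proof (rule bij_betw_imageI)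
    show "inj_on (map_prod (shift m) (shift m)) (le_rel Z)"
      using map_prod_inj_on[OF inj inj] le_rel_in by (rule inj_on_subset)
    show "map_prod (shift m) (shift m) ` le_rel Z = le_rel Z"
    proof (intro equalityI subsetI)
      fix p assume "p \<in> map_prod (shift m) (shift m) ` le_rel Z"
      then show "p \<in> le_rel Z" using mono le_rel_in by auto
    next
      fix p assume p: "p \<in> le_rel Z"
      then have "fst p \<in> verts Z" "snd p \<in> verts Z" using le_rel_in by auto
      then obtain a b where ab: "a \<in> verts Z" "b \<in> verts Z" "p = (shift m a, shift m b)"
        using surj by (metis prod.collapse)
      then have "(a, b) \<in> le_rel Z" using p mono by auto
      then show "p \<in> map_prod (shift m) (shift m) ` le_rel Z" using ab by (auto intro!: rev_image_eqI)
    qed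
  qed
  ultimately show ?thesis unfolding m plus_shift is_isomorphism_def
    by (simp add: le_category_def order_category_def order_functor_def)
qed

lemma plus_auts_partial_order:
  "partial_order_on (plus_auts Z zero) (plus_auts_le Z zero)"
proof -
  have tr: "trans (le_rel Z)" and an: "antisym (le_rel Z)"
    and rf: "\<And>a. a \<in> verts Z \<Longrightarrow> (a, a) \<in> le_rel Z"
    using le_rel_linear_order
    by (auto simp: linear_order_on_def partial_order_on_def preorder_on_def refl_on_def)
  have ext: "F \<in> extensional (verts Z)" "\<And>a. a \<in> verts Z \<Longrightarrow> F a \<in> verts Z"
    if F: "F \<in> plus_auts Z zero" for F
  proof -
    obtain x where "x \<in> verts Z" "F = plus_aut Z zero x" using F by (auto simp: plus_auts_def)
    then obtain m where "F = shift m" using plus_shift ch_surj by metis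
    then show "F \<in> extensional (verts Z)" "\<And>a. a \<in> verts Z \<Longrightarrow> F a \<in> verts Z"
      by (auto simp: shift_def ch_in)
  qed
  have "F = G" if "(F, G) \<in> plus_auts_le Z zero" "(G, F) \<in> plus_auts_le Z zero" for F G
  proof (rule extensionalityI)
    show "F \<in> extensional (verts Z)" "G \<in> extensional (verts Z)"
      using that ext by (auto simp: plus_auts_le_def)
    fix a assume "a \<in> verts Z"
    then show "F a = G a" using that an by (auto simp: plus_auts_le_def dest: antisymD)
  qed
  then have "antisym (plus_auts_le Z zero)" by (rule antisymI)
  moreover have "trans (plus_auts_le Z zero)"
    using tr by (auto simp: plus_auts_le_def trans_def)
  moreover have "refl_on (plus_auts Z zero) (plus_auts_le Z zero)"
    using rf ext by (auto simp: plus_auts_le_def refl_on_def)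
  ultimately show ?thesis
    by (auto simp: partial_order_on_def preorder_on_def plus_auts_le_def)
qed

end

lemma discrete_number_system_int:
  "discrete_number_system
     \<lparr>verts = UNIV :: int set, arcs = UNIV, tail = id, head = (\<lambda>n. n + 1)\<rparr> 0"
  (is "discrete_number_system ?Z 0")
proof
  let ?r = "{(m, n). m < (n :: int)}"
  show "\<exists>r. strict_linear_order_on (verts ?Z) r \<and> arcs_ends ?Z \<subseteq> r"
    by (rule exI[of _ ?r]) (auto simp: strict_linear_order_on_def trans_def irrefl_def total_on_def arcs_ends_conv)
  have st: "(n, n + 1) \<in> (arcs_ends ?Z)\<^sup>s" "(n, n - 1) \<in> (arcs_ends ?Z)\<^sup>s" for n :: int
    by (auto simp: symcl_def arcs_ends_conv image_iff intro: exI[of _ "n - 1"])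
  have "(m, n) \<in> rtrancl_on UNIV ((arcs_ends ?Z)\<^sup>s)" for m n :: int
    by (induction n rule: int_induct[of _ m]) (use st in \<open>auto simp del: id_apply intro: rtrancl_on_into_rtrancl_on\<close>)
  then show "connected ?Z" by (simp add: connected_conv)
  show "\<exists>!e. e \<in> in_arcs ?Z x" for x by (rule ex1I[of _ "x - 1"]) auto
qed auto

end

theory Submission
  imports Defs
begin

text \<open>
  Index the objects of \<open>Z\<close> by the integers through \<open>ch\<close>. The order of \<open>Z\<close> becomes the usual order
  of the integers and \<open>+(ch m)\<close> becomes translation by \<open>m\<close>. At every single point \<open>n\<close> the values
  \<open>n + k\<close> and \<open>n + m\<close> of two translations compare exactly as \<open>k\<close> and \<open>m\<close> do. So the pointwise
  order of the automorphisms reproduces the order of \<open>Z\<close>, which makes \<open>x \<mapsto> +x\<close> an order isomorphism.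
  Both claims then reduce to general facts about partial orders seen as categories: a surjection that
  preserves and reflects the order is an isomorphism of categories, and a pointwise inequality of two
  order preserving functions is a natural transformation, since all diagrams in a partial order
  commute.
\<close>

lemma is_category_order_category:
  assumes "partial_order_on A r"
  shows "is_category (order_category A r)"
  using partial_order_onD[OF assms] unfolding is_category_def order_category_def hom_set_def
  by (auto simp: refl_on_def dest: transD)

text \<open>
  Injectivity comes for free: if \<open>f x = f y\<close>, reflexivity of \<open>s\<close> and reflection of the order give
  both \<open>x \<le> y\<close> and \<open>y \<le> x\<close>.
\<close>

lemma is_isomorphism_order_functor:
  assumes r: "partial_order_on A r" and s: "partial_order_on B s"
    and surj: "f ` A = B"
    and order: "\<And>x y. x \<in> A \<Longrightarrow> y \<in> A \<Longrightarrow> (f x, f y) \<in> s \<longleftrightarrow> (x, y) \<in> r"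
  shows "is_isomorphism (order_category A r) (order_category B s) (order_functor f)"
proof -
  have r_in: "r \<subseteq> A \<times> A" and s_in: "s \<subseteq> B \<times> B" and anti: "antisym r" and refl: "refl_on B s"
    using r s by (auto simp: partial_order_on_def preorder_on_def)
  have inj: "inj_on f A"
  proof (rule inj_onI)
    fix x y assume xy: "x \<in> A" "y \<in> A" "f x = f y"
    then have "(f x, f y) \<in> s" "(f y, f x) \<in> s"
      using refl surj by (auto simp: refl_on_def)
    then have "(x, y) \<in> r" "(y, x) \<in> r" using order xy(1,2) by blast+
    then show "x = y" by (rule antisymD[OF anti])
  qed
  have "is_category (order_category A r)" "is_category (order_category B s)"
    using r s by (auto intro: is_category_order_category)
  then have "is_functor (order_category A r) (order_category B s) (order_functor f)"
    using surj order unfolding is_functor_def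
    by (auto simp: order_category_def order_functor_def hom_set_def)
  moreover have "bij_betw (map_prod f f) r s"
  proof (rule bij_betw_imageI)
    show "inj_on (map_prod f f) r"
      using map_prod_inj_on[OF inj inj] r_in by (rule inj_on_subset)
    show "map_prod f f ` r = s"
    proof (intro equalityI subrelI)
      fix u v assume "(u, v) \<in> map_prod f f ` r"
      then show "(u, v) \<in> s" using order r_in by auto
    next
      fix u v assume uv: "(u, v) \<in> s"
      then have "u \<in> f ` A" "v \<in> f ` A" using s_in surj by auto
      then obtain x y where "x \<in> A" "y \<in> A" "u = f x" "v = f y" by blast
      then show "(u, v) \<in> map_prod f f ` r" using order uv by force
    qed
  qed
  ultimately show ?thesis
    using inj surj
    by (simp add: is_isomorphism_def bij_betw_def order_category_def order_functor_def)
qed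

lemma is_natural_transformation_order_functor:
  assumes "is_functor (order_category A r) (order_category B s) (order_functor f)"
    and "is_functor (order_category A r) (order_category B s) (order_functor g)"
    and "\<And>x. x \<in> A \<Longrightarrow> (f x, g x) \<in> s"
  shows "is_natural_transformation (order_category A r) (order_category B s)
           (order_functor f) (order_functor g) (\<lambda>x. (f x, g x))"
  using assms unfolding is_natural_transformation_def
  by (auto simp: order_category_def order_functor_def hom_set_def)

context discrete_number_system
begin

text \<open>
  With \<open>x = ch k\<close>, \<open>y = ch m\<close> and \<open>a = ch n\<close> this is cancellation of \<open>n\<close> in \<open>n + k \<le> n + m\<close>. One
  object \<open>a\<close> thus decides the order, so the pointwise order below reflects that of \<open>Z\<close> by evaluation
  at \<open>zero\<close>.
\<close>

lemma plus_aut_le_at_iff: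
  assumes "x \<in> verts Z" "y \<in> verts Z" "a \<in> verts Z"
  shows "(plus_aut Z zero x a, plus_aut Z zero y a) \<in> le_rel Z \<longleftrightarrow> (x, y) \<in> le_rel Z"
  using assms by (auto simp: plus_shift le_ch_iff elim!: ch_surj)

lemma plus_auts_le_iff:
  assumes "x \<in> verts Z" "y \<in> verts Z"
  shows "(plus_aut Z zero x, plus_aut Z zero y) \<in> plus_auts_le Z zero \<longleftrightarrow> (x, y) \<in> le_rel Z"
  using assms zero_in_verts by (auto simp: plus_auts_le_def plus_auts_def plus_aut_le_at_iff)

lemma is_isomorphism_plus_aut:
  "is_isomorphism (le_category Z) (plus_auts_category Z zero) (order_functor (plus_aut Z zero))"
  unfolding le_category_def plus_auts_category_def
  using le_rel_linear_order plus_auts_partial_order plus_auts_le_iff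
  by (intro is_isomorphism_order_functor) (auto simp: linear_order_on_def plus_auts_def)

lemma is_natural_transformation_plus_aut:
  assumes "(x, y) \<in> le_rel Z"
  shows "is_natural_transformation (le_category Z) (le_category Z)
           (order_functor (plus_aut Z zero x)) (order_functor (plus_aut Z zero y))
           (\<lambda>a. (plus_aut Z zero x a, plus_aut Z zero y a))"
proof -
  have xy: "x \<in> verts Z" "y \<in> verts Z" using assms le_rel_in by auto
  show ?thesis
    using plus_automorphism[OF xy(1)] plus_automorphism[OF xy(2)] plus_aut_le_at_iff[OF xy] assms
    unfolding le_category_def is_isomorphism_def
    by (intro is_natural_transformation_order_functor) auto
qed

end

theorem theorem6p2:
  fixes Z :: "('o, 'a) pre_digraph" and zero :: 'o
  assumes "discrete_number_system Z zero"
  shows "(\<exists>oplus. is_isomorphism (le_category Z) (plus_auts_category Z zero) oplus \<and>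
            (\<forall>x\<in>verts Z. obj_map oplus x = plus_aut Z zero x)) \<and>
         (\<forall>a b. (a, b) \<in> le_rel Z \<longrightarrow>
            (\<exists>\<eta>. is_natural_transformation (le_category Z) (le_category Z)
                   (order_functor (plus_aut Z zero a)) (order_functor (plus_aut Z zero b)) \<eta>))"
proof -
  interpret discrete_number_system Z zero by (rule assms)
  have "obj_map (order_functor (plus_aut Z zero)) x = plus_aut Z zero x" for x
    by (simp add: order_functor_def)
  then show ?thesis
    using is_isomorphism_plus_aut is_natural_transformation_plus_aut by blast
qed

end
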